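(* Let $X$ be a Tychonoff space which is a $\mu$-space and a sequentially Ascoli space. Then the free locally convex space $L(X)$ over $X$ is a $c_0$-quasibarrelled space.
   Context: Locally convex spaces (lcs) are real and Hausdorff; Tychonoff means completely regular and Hausdorff. The free locally convex space over a Tychonoff space $X$ is an lcs $L(X)$ with a continuous map $i:X\to L(X)$ such that for every continuous map $f$ from $X$ to an lcs $E$ there is a unique continuous linear operator $\bar f:L(X)\to E$ with $f=\bar f\circ i$. It exists and is essentially unique, and $i$ is a topological embedding whose image is a Hamel basis of $L(X)$. A subset $A$ of $X$ is functionally bounded in $X$ if every continuous $f:X\to\mathbb{R}$ is bounded on $A$; $X$ is a $\mu$-space if every functionally bounded subset of $X$ has compact closure. $C_k(X)$ is the space $C(X)$ of continuous real-valued functions on $X$ with the compact-open topology. $X$ is sequentially Ascoli if every convergent sequence in $C_k(X)$ is equicontinuous (as a family of functions on $X$). For an lcs $E$ with dual $E'$, $\beta(E',E)$ is the strong topology (uniform convergence on bounded subsets of $E$). A subset of $E'$ is equicontinuous if it is contained in the polar $U^\circ=\{\chi\in E':|\chi(x)|\le 1\ \forall x\in U\}$ of some neighborhood $U$ of zero in $E$. $E$ is $c_0$-quasibarrelled if every $\beta(E',E)$-null sequence in $E'$ is equicontinuous. *)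

theory Defs
  imports "HOL-Analysis.Analysis" "HOL-Analysis.Finite_Function_Topology"
begin

section \<open>Function spaces on a topological space\<close>

definition tychonoff_space :: "'x topology \<Rightarrow> bool" where
  "tychonoff_space X \<longleftrightarrow> completely_regular_space X \<and> Hausdorff_space X"

definition functionally_bounded :: "'x topology \<Rightarrow> 'x set \<Rightarrow> bool" where
  "functionally_bounded X A \<longleftrightarrow> A \<subseteq> topspace X \<and>
     (\<forall>f. continuous_map X euclideanreal f \<longrightarrow> bounded (f ` A))"

definition mu_space :: "'x topology \<Rightarrow> bool" where
  "mu_space X \<longleftrightarrow> (\<forall>A. functionally_bounded X A \<longrightarrow> compactin X (X closure_of A))"

text \<open>Functions on a subset of a type are normalised to be \<^const>\<open>undefined\<close> outside of it, so that
  equality of elements of \<open>C(X)\<close> is equality on the points of \<open>X\<close>.\<close>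

definition cont_funs :: "'x topology \<Rightarrow> ('x \<Rightarrow> real) set" where
  "cont_funs X = {f \<in> extensional (topspace X). continuous_map X euclideanreal f}"

definition compact_open_topology :: "'x topology \<Rightarrow> ('x \<Rightarrow> real) topology" where
  "compact_open_topology X = topology_generated_by
     {{f \<in> cont_funs X. f ` K \<subseteq> U} |K U. compactin X K \<and> open U}"

definition equicontinuous_family :: "'x topology \<Rightarrow> ('x \<Rightarrow> real) set \<Rightarrow> bool" where
  "equicontinuous_family X F \<longleftrightarrow>
     (\<forall>x\<in>topspace X. \<forall>e>0. \<exists>W. openin X W \<and> x \<in> W \<and> (\<forall>f\<in>F. \<forall>y\<in>W. \<bar>f y - f x\<bar> < e))"

definition sequentially_ascoli :: "'x topology \<Rightarrow> bool" where
  "sequentially_ascoli X \<longleftrightarrow>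
     (\<forall>f g. (\<forall>n. f n \<in> cont_funs X) \<and> limitin (compact_open_topology X) f g sequentially
        \<longrightarrow> equicontinuous_family X (range f))"

section \<open>Locally convex spaces\<close>

text \<open>A locally convex space is given by its topology, a linear subspace of an ambient real vector
  space being its set of points. The topology of the ambient type, if any, plays no role.\<close>

definition lcs :: "'e::real_vector topology \<Rightarrow> bool" where
  "lcs E \<longleftrightarrow> subspace (topspace E) \<and> Hausdorff_space E \<and>
     continuous_map (prod_topology E E) E (\<lambda>(x, y). x + y) \<and>
     continuous_map (prod_topology euclideanreal E) E (\<lambda>(c, x). c *\<^sub>R x) \<and>
     neighbourhood_base_at 0 convex E"

definition linear_map_on :: "'e::real_vector set \<Rightarrow> ('e \<Rightarrow> 'f::real_vector) \<Rightarrow> bool" where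
  "linear_map_on S f \<longleftrightarrow>
     (\<forall>x\<in>S. \<forall>y\<in>S. f (x + y) = f x + f y) \<and> (\<forall>c. \<forall>x\<in>S. f (c *\<^sub>R x) = c *\<^sub>R f x)"

definition continuous_operators ::
    "'e::real_vector topology \<Rightarrow> 'f::real_vector topology \<Rightarrow> ('e \<Rightarrow> 'f) set" where
  "continuous_operators E F =
     {f \<in> extensional (topspace E). linear_map_on (topspace E) f \<and> continuous_map E F f}"

abbreviation dual :: "'e::real_vector topology \<Rightarrow> ('e \<Rightarrow> real) set" where
  "dual E \<equiv> continuous_operators E euclideanreal"

definition zero_nbhd :: "'e::real_vector topology \<Rightarrow> 'e set \<Rightarrow> bool" where
  "zero_nbhd E U \<longleftrightarrow> U \<subseteq> topspace E \<and> (\<exists>W. openin E W \<and> 0 \<in> W \<and> W \<subseteq> U)"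

definition lcs_bounded :: "'e::real_vector topology \<Rightarrow> 'e set \<Rightarrow> bool" where
  "lcs_bounded E B \<longleftrightarrow> B \<subseteq> topspace E \<and>
     (\<forall>U. zero_nbhd E U \<longrightarrow> (\<exists>s>0. \<forall>t. s \<le> \<bar>t\<bar> \<longrightarrow> B \<subseteq> (*\<^sub>R) t ` U))"

definition strong_topology :: "'e::real_vector topology \<Rightarrow> ('e \<Rightarrow> real) topology" where
  "strong_topology E = topology (\<lambda>W. W \<subseteq> dual E \<and>
     (\<forall>\<phi>\<in>W. \<exists>B e. lcs_bounded E B \<and> e > 0 \<and> {\<psi>\<in>dual E. \<forall>x\<in>B. \<bar>\<psi> x - \<phi> x\<bar> < e} \<subseteq> W))"

definition zero_functional :: "'e::real_vector topology \<Rightarrow> 'e \<Rightarrow> real" where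
  "zero_functional E = restrict (\<lambda>_. 0) (topspace E)"

definition polar :: "'e::real_vector topology \<Rightarrow> 'e set \<Rightarrow> ('e \<Rightarrow> real) set" where
  "polar E U = {\<phi> \<in> dual E. \<forall>x\<in>U. \<bar>\<phi> x\<bar> \<le> 1}"

definition equicontinuous_functionals :: "'e::real_vector topology \<Rightarrow> ('e \<Rightarrow> real) set \<Rightarrow> bool" where
  "equicontinuous_functionals E H \<longleftrightarrow> (\<exists>U. zero_nbhd E U \<and> H \<subseteq> polar E U)"

definition c0_quasibarrelled :: "'e::real_vector topology \<Rightarrow> bool" where
  "c0_quasibarrelled E \<longleftrightarrow> lcs E \<and>
     (\<forall>\<phi>. (\<forall>n. \<phi> n \<in> dual E) \<and> limitin (strong_topology E) \<phi> (zero_functional E) sequentially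
        \<longrightarrow> equicontinuous_functionals E (range \<phi>))"

section \<open>Free locally convex spaces\<close>

definition extends_uniquely ::
    "'x topology \<Rightarrow> 'l::real_vector topology \<Rightarrow> ('x \<Rightarrow> 'l) \<Rightarrow> 'e::real_vector topology \<Rightarrow> bool" where
  "extends_uniquely X L i E \<longleftrightarrow> (\<forall>f. continuous_map X E f \<longrightarrow>
     (\<exists>!g. g \<in> continuous_operators L E \<and> (\<forall>x\<in>topspace X. g (i x) = f x)))"

text \<open>The universal property speaks about all locally convex spaces, and HOL cannot quantify over
  types. It is required here for the spaces lying in two types: the type of \<open>L\<close> itself, and the
  type \<open>'x \<Rightarrow>\<^sub>0 real\<close>, the free real vector space over \<open>'x\<close>. Lemma \<open>free_lcs_universal\<close>
  below shows that it then holds for the locally convex spaces in any type whatsoever, and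
  \<open>free_lcs_exists\<close> that such spaces exist for all Tychonoff \<open>X\<close>.\<close>

definition free_lcs :: "'x topology \<Rightarrow> 'l::real_vector topology \<Rightarrow> ('x \<Rightarrow> 'l) \<Rightarrow> bool" where
  "free_lcs X L i \<longleftrightarrow> lcs L \<and> continuous_map X L i \<and>
     (\<forall>E :: 'l topology. lcs E \<longrightarrow> extends_uniquely X L i E) \<and>
     (\<forall>E :: ('x \<Rightarrow>\<^sub>0 real) topology. lcs E \<longrightarrow> extends_uniquely X L i E)"

section \<open>The strong topology is a topology\<close>

lemma lcs_bounded_Un:
  assumes "lcs_bounded E A" "lcs_bounded E B" shows "lcs_bounded E (A \<union> B)"
  unfolding lcs_bounded_def
proof (intro conjI allI impI)
  show "A \<union> B \<subseteq> topspace E" using assms by (auto simp: lcs_bounded_def)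
next
  fix U assume U: "zero_nbhd E U"
  obtain s where s: "s > 0" "\<And>t. s \<le> \<bar>t\<bar> \<Longrightarrow> A \<subseteq> (*\<^sub>R) t ` U"
    using assms(1) U unfolding lcs_bounded_def by blast
  obtain r where r: "r > 0" "\<And>t. r \<le> \<bar>t\<bar> \<Longrightarrow> B \<subseteq> (*\<^sub>R) t ` U"
    using assms(2) U unfolding lcs_bounded_def by blast
  show "\<exists>s>0. \<forall>t. s \<le> \<bar>t\<bar> \<longrightarrow> A \<union> B \<subseteq> (*\<^sub>R) t ` U"
    using s r by (intro exI[of _ "max s r"]) auto
qed

lemma istopology_strong:
  "istopology (\<lambda>W. W \<subseteq> dual E \<and>
     (\<forall>\<phi>\<in>W. \<exists>B e. lcs_bounded E B \<and> e > 0 \<and> {\<psi>\<in>dual E. \<forall>x\<in>B. \<bar>\<psi> x - \<phi> x\<bar> < e} \<subseteq> W))"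
  (is "istopology (\<lambda>W. W \<subseteq> _ \<and> (\<forall>\<phi>\<in>W. ?P \<phi> W))")
  unfolding istopology_def
proof (intro conjI allI impI)
  fix S T assume S: "S \<subseteq> dual E \<and> (\<forall>\<phi>\<in>S. ?P \<phi> S)" and T: "T \<subseteq> dual E \<and> (\<forall>\<phi>\<in>T. ?P \<phi> T)"
  show "S \<inter> T \<subseteq> dual E" using S by blast
  show "\<forall>\<phi>\<in>S \<inter> T. ?P \<phi> (S \<inter> T)"
  proof
    fix \<phi> assume \<phi>: "\<phi> \<in> S \<inter> T"
    obtain A a where A: "lcs_bounded E A" "a > 0" "{\<psi>\<in>dual E. \<forall>x\<in>A. \<bar>\<psi> x - \<phi> x\<bar> < a} \<subseteq> S"
      using S \<phi> by blast
    obtain B b where B: "lcs_bounded E B" "b > 0" "{\<psi>\<in>dual E. \<forall>x\<in>B. \<bar>\<psi> x - \<phi> x\<bar> < b} \<subseteq> T"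
      using T \<phi> by blast
    have "{\<psi>\<in>dual E. \<forall>x\<in>A \<union> B. \<bar>\<psi> x - \<phi> x\<bar> < min a b} \<subseteq> S \<inter> T"
      using A(3) B(3) by auto
    then show "?P \<phi> (S \<inter> T)"
      using A B lcs_bounded_Un by (intro exI[of _ "A \<union> B"] exI[of _ "min a b"]) auto
  qed
next
  fix K assume K: "\<forall>W\<in>K. W \<subseteq> dual E \<and> (\<forall>\<phi>\<in>W. ?P \<phi> W)"
  then show "\<Union>K \<subseteq> dual E" by blast
  show "\<forall>\<phi>\<in>\<Union>K. ?P \<phi> (\<Union>K)" using K by (meson Sup_upper UnionE subset_trans)
qed

lemma openin_strong_topology:
  "openin (strong_topology E) W \<longleftrightarrow> W \<subseteq> dual E \<and>
     (\<forall>\<phi>\<in>W. \<exists>B e. lcs_bounded E B \<and> e > 0 \<and> {\<psi>\<in>dual E. \<forall>x\<in>B. \<bar>\<psi> x - \<phi> x\<bar> < e} \<subseteq> W)"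
  unfolding strong_topology_def by (rule fun_cong[OF topology_inverse'[OF istopology_strong]])

section \<open>Existence and universality of the free locally convex space\<close>

lemma lcs_subspace: "lcs E \<Longrightarrow> subspace (topspace E)"
  by (simp add: lcs_def)

lemma lcs_translate:
  assumes E: "lcs E" and W: "openin E W" and w: "w \<in> W"
  shows "\<exists>G. openin E G \<and> 0 \<in> G \<and> (\<forall>u\<in>G. w + u \<in> W)"
proof -
  have wE: "w \<in> topspace E" using W w openin_subset by blast
  have c: "continuous_map E E ((\<lambda>(x, y). x + y) \<circ> (\<lambda>u. (w, u)))"
    using E wE by (intro continuous_map_compose[where X'="prod_topology E E"])
      (auto simp: lcs_def continuous_map_pairedI)
  have "openin E {u \<in> topspace E. w + u \<in> W}"
    using openin_continuous_map_preimage[OF c W] by simp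
  moreover have "0 \<in> topspace E" using lcs_subspace[OF E] subspace_0 by blast
  ultimately show ?thesis using w by (intro exI[of _ "{u \<in> topspace E. w + u \<in> W}"]) auto
qed

lemma lcs_scale:
  assumes E: "lcs E" and W: "openin E W"
  shows "openin E {u \<in> topspace E. c *\<^sub>R u \<in> W}"
proof -
  have c: "continuous_map E E ((\<lambda>(c, y). c *\<^sub>R y) \<circ> (\<lambda>u. (c, u)))"
    using E by (intro continuous_map_compose[where X'="prod_topology euclideanreal E"])
      (auto simp: lcs_def continuous_map_pairedI)
  show ?thesis
    using openin_continuous_map_preimage[OF c W] by simp
qed

lemma lcs_disk:
  assumes E: "lcs E" and W: "openin E W" and w: "0 \<in> W"
  shows "\<exists>V G. convex V \<and> (\<forall>v\<in>V. - v \<in> V) \<and> V \<subseteq> W \<and> openin E G \<and> 0 \<in> G \<and> G \<subseteq> V"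
proof -
  obtain G V where G: "openin E G" "convex V" "0 \<in> G" "G \<subseteq> V" "V \<subseteq> W"
    using E W w unfolding lcs_def neighbourhood_base_at_def by metis
  let ?V = "V \<inter> uminus ` V" and ?G = "G \<inter> {u \<in> topspace E. (-1) *\<^sub>R u \<in> G}"
  have "convex ?V" using G(2) by (intro convex_Int convex_negations)
  moreover have "\<forall>v\<in>?V. - v \<in> ?V" by auto
  moreover have "openin E ?G" using G(1) lcs_scale[OF E G(1)] by (intro openin_Int)
  moreover have "0 \<in> ?G" using G(1,3) openin_subset by auto
  moreover have "?G \<subseteq> ?V"
  proof
    fix g assume g: "g \<in> ?G"
    then have "g \<in> V" "- g \<in> V" using G(4) by auto
    then show "g \<in> ?V" by (simp add: image_iff) (metis minus_minus)
  qed
  moreover have "?V \<subseteq> W" using G(5) by blast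
  ultimately show ?thesis by blast
qed

lemma linear_map_on_sum:
  assumes "subspace S" "linear_map_on S h" "finite A" "\<And>a. a \<in> A \<Longrightarrow> g a \<in> S"
  shows "h (\<Sum>a\<in>A. c a *\<^sub>R g a) = (\<Sum>a\<in>A. c a *\<^sub>R h (g a))"
  using assms(3,4)
proof (induction A rule: finite_induct)
  case empty
  have "h (0 *\<^sub>R 0) = 0 *\<^sub>R h 0"
    using assms(1,2) subspace_0 unfolding linear_map_on_def by blast
  then show ?case by simp
next
  case (insert a A)
  have 1: "c a *\<^sub>R g a \<in> S" using insert assms(1) by (simp add: subspace_scale)
  have 2: "(\<Sum>a\<in>A. c a *\<^sub>R g a) \<in> S"
    using insert assms(1) by (intro subspace_sum) (auto simp: subspace_scale)
  show ?case using insert assms(2) 1 2 by (simp add: linear_map_on_def)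
qed

lemma linear_map_on_compose:
  assumes "linear_map_on S h" "linear_map_on T k" "\<And>x. x \<in> S \<Longrightarrow> h x \<in> T"
  shows "linear_map_on S (\<lambda>x. k (h x))"
  using assms by (simp add: linear_map_on_def)

lemma linear_map_on_restrict:
  assumes "subspace S" "linear_map_on S f" shows "linear_map_on S (restrict f S)"
  unfolding linear_map_on_def
proof (intro conjI ballI allI)
  fix x y assume xy: "x \<in> S" "y \<in> S"
  then have "x + y \<in> S" using assms(1) by (simp add: subspace_add)
  then show "restrict f S (x + y) = restrict f S x + restrict f S y"
    using xy assms(2) by (simp add: linear_map_on_def)
next
  fix c x assume x: "x \<in> S"
  then have "c *\<^sub>R x \<in> S" using assms(1) by (simp add: subspace_scale)
  then show "restrict f S (c *\<^sub>R x) = c *\<^sub>R restrict f S x"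
    using x assms(2) by (simp add: linear_map_on_def)
qed

lemma continuous_operators_compose:
  assumes S: "subspace (topspace E)" and h: "h \<in> continuous_operators E F" and k: "k \<in> continuous_operators F G"
  shows "restrict (\<lambda>x. k (h x)) (topspace E) \<in> continuous_operators E G"
proof -
  have m: "h x \<in> topspace F" if "x \<in> topspace E" for x
    using h that by (auto simp: continuous_operators_def continuous_map_def)
  have "linear_map_on (topspace E) (\<lambda>x. k (h x))"
    by (rule linear_map_on_compose[of _ h "topspace F"])
      (use h k m in \<open>auto simp: continuous_operators_def\<close>)
  then have "linear_map_on (topspace E) (restrict (\<lambda>x. k (h x)) (topspace E))"
    by (rule linear_map_on_restrict[OF S])
  moreover have "continuous_map E G (k \<circ> h)"
    using h k by (intro continuous_map_compose[where X'=F]) (auto simp: continuous_operators_def)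
  then have "continuous_map E G (restrict (\<lambda>x. k (h x)) (topspace E))"
    by (rule continuous_map_eq) simp
  ultimately show ?thesis by (simp add: continuous_operators_def)
qed

definition free_space :: "'x set \<Rightarrow> ('x \<Rightarrow>\<^sub>0 real) set" where
  "free_space S = {p. Poly_Mapping.keys p \<subseteq> S}"

abbreviation delta :: "'x \<Rightarrow> ('x \<Rightarrow>\<^sub>0 real)" where
  "delta x \<equiv> Poly_Mapping.single x 1"

definition free_extend :: "('x \<Rightarrow> 'e::real_vector) \<Rightarrow> ('x \<Rightarrow>\<^sub>0 real) \<Rightarrow> 'e" where
  "free_extend f p = (\<Sum>x\<in>Poly_Mapping.keys p. Poly_Mapping.lookup p x *\<^sub>R f x)"

lemma lookup_scaleR [simp]:
  "Poly_Mapping.lookup (c *\<^sub>R (p :: 'x \<Rightarrow>\<^sub>0 real)) x = c * Poly_Mapping.lookup p x"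
proof -
  have "finite {i. c *\<^sub>R Poly_Mapping.lookup p i \<noteq> 0}"
    by (rule finite_subset[OF _ finite_keys[of p]]) (auto simp: in_keys_iff)
  then show ?thesis by (simp add: scaleR_poly_mapping_def)
qed

lemma free_extend_superset:
  assumes "finite A" "Poly_Mapping.keys p \<subseteq> A"
  shows "free_extend f p = (\<Sum>x\<in>A. Poly_Mapping.lookup p x *\<^sub>R f x)"
  unfolding free_extend_def using assms by (intro sum.mono_neutral_left) (auto simp: in_keys_iff)

lemma free_extend_add: "free_extend f (p + q) = free_extend f p + free_extend f q"
proof -
  let ?A = "Poly_Mapping.keys p \<union> Poly_Mapping.keys q"
  have "free_extend f r = (\<Sum>x\<in>?A. Poly_Mapping.lookup r x *\<^sub>R f x)" if "r \<in> {p, q, p + q}" for r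
    using that keys_add[of p q] by (intro free_extend_superset) auto
  then show ?thesis by (simp add: lookup_add scaleR_add_left sum.distrib)
qed

lemma free_extend_scale: "free_extend f (c *\<^sub>R p) = c *\<^sub>R free_extend f p"
proof -
  have "free_extend f (c *\<^sub>R p) = (\<Sum>x\<in>Poly_Mapping.keys p. Poly_Mapping.lookup (c *\<^sub>R p) x *\<^sub>R f x)"
    by (intro free_extend_superset) (auto simp: in_keys_iff)
  then show ?thesis by (simp add: free_extend_def scaleR_sum_right)
qed

lemma linear_free_extend: "linear (free_extend f)"
  by (intro linearI free_extend_add free_extend_scale)

lemma free_extend_delta [simp]: "free_extend f (delta x) = f x"
  by (simp add: free_extend_def)

lemma free_extend_id: "free_extend delta p = p"
proof (rule poly_mapping_eqI)
  fix y
  have "Poly_Mapping.lookup (free_extend delta p) y =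
      (\<Sum>x\<in>Poly_Mapping.keys p. Poly_Mapping.lookup p x * Poly_Mapping.lookup (delta x) y)"
    by (simp add: free_extend_def lookup_sum)
  also have "\<dots> = (\<Sum>x\<in>Poly_Mapping.keys p. if x = y then Poly_Mapping.lookup p y else 0)"
    by (intro sum.cong) (auto simp: lookup_single when_def)
  also have "\<dots> = Poly_Mapping.lookup p y"
    by (auto simp: in_keys_iff)
  finally show "Poly_Mapping.lookup (free_extend delta p) y = Poly_Mapping.lookup p y" .
qed

lemma subspace_free_space: "subspace (free_space S)"
proof -
  have "free_space S = {p. \<forall>x. x \<notin> S \<longrightarrow> Poly_Mapping.lookup p x = 0}"
    by (auto simp: free_space_def in_keys_iff)
  then show ?thesis by (simp add: subspace_def lookup_add)
qed

lemma delta_free_space [simp]: "delta x \<in> free_space S \<longleftrightarrow> x \<in> S"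
  by (simp add: free_space_def)

lemma free_extend_mem:
  assumes "subspace T" "\<And>x. x \<in> S \<Longrightarrow> f x \<in> T" "p \<in> free_space S"
  shows "free_extend f p \<in> T"
  using assms unfolding free_extend_def free_space_def
  by (intro subspace_sum) (auto intro!: subspace_scale)

lemma linear_map_on_free_space:
  assumes "linear_map_on (free_space S) h" "p \<in> free_space S"
  shows "h p = free_extend (\<lambda>x. h (delta x)) p"
proof -
  have "h p = h (\<Sum>x\<in>Poly_Mapping.keys p. Poly_Mapping.lookup p x *\<^sub>R delta x)"
    using free_extend_id[of p] by (simp add: free_extend_def)
  also have "\<dots> = free_extend (\<lambda>x. h (delta x)) p"
    unfolding free_extend_def
    using assms subspace_free_space
    by (intro linear_map_on_sum[where S="free_space S"]) (auto simp: free_space_def)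
  finally show ?thesis .
qed

text \<open>The absolutely convex neighbourhoods of zero in the finest locally convex topology that makes
  \<^term>\<open>delta\<close> continuous.\<close>

definition free_disk :: "'x topology \<Rightarrow> ('x \<Rightarrow>\<^sub>0 real) set \<Rightarrow> bool" where
  "free_disk X U \<longleftrightarrow> U \<subseteq> free_space (topspace X) \<and> convex U \<and> 0 \<in> U \<and> (\<forall>u\<in>U. - u \<in> U) \<and>
     (\<forall>v\<in>free_space (topspace X). \<exists>t>0. t *\<^sub>R v \<in> U) \<and>
     (\<forall>x\<in>topspace X. \<forall>c. \<exists>G. openin X G \<and> x \<in> G \<and> (\<forall>y\<in>G. c *\<^sub>R (delta y - delta x) \<in> U))"

definition free_topology :: "'x topology \<Rightarrow> ('x \<Rightarrow>\<^sub>0 real) topology" where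
  "free_topology X = topology (\<lambda>W. W \<subseteq> free_space (topspace X) \<and>
     (\<forall>w\<in>W. \<exists>U. free_disk X U \<and> (\<forall>u\<in>U. w + u \<in> W)))"

lemma convex_sym_scale:
  fixes U :: "'e::real_vector set"
  assumes "convex U" "0 \<in> U" "\<forall>u\<in>U. - u \<in> U" "u \<in> U" "\<bar>c\<bar> \<le> 1"
  shows "c *\<^sub>R u \<in> U"
proof -
  have p: "c *\<^sub>R u \<in> U" if "0 \<le> c" "c \<le> 1" "u \<in> U" for c u
    using convexD[OF assms(1) that(3) assms(2), of c "1 - c"] that by simp
  show ?thesis
  proof (cases "c \<ge> 0")
    case True then show ?thesis using p assms by auto
  next
    case False then show ?thesis using p[of "- c" "- u"] assms by auto
  qed
qed

lemma free_disk_scale1: "free_disk X U \<Longrightarrow> u \<in> U \<Longrightarrow> \<bar>c\<bar> \<le> 1 \<Longrightarrow> c *\<^sub>R u \<in> U"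
  unfolding free_disk_def by (metis convex_sym_scale)

lemma free_disk_half:
  assumes "free_disk X U" "2 *\<^sub>R u \<in> U" "2 *\<^sub>R v \<in> U" shows "u + v \<in> U"
proof -
  have "(1/2) *\<^sub>R (2 *\<^sub>R u) + (1/2) *\<^sub>R (2 *\<^sub>R v) \<in> U"
    using assms by (intro convexD) (auto simp: free_disk_def)
  then show ?thesis by simp
qed

lemma free_disk_Int:
  assumes U: "free_disk X U" and V: "free_disk X V" shows "free_disk X (U \<inter> V)"
  unfolding free_disk_def
proof (intro conjI ballI allI)
  show "U \<inter> V \<subseteq> free_space (topspace X)" "convex (U \<inter> V)" "0 \<in> U \<inter> V"
    using assms by (auto simp: free_disk_def convex_Int)
  fix u assume "u \<in> U \<inter> V" then show "- u \<in> U \<inter> V" using assms by (auto simp: free_disk_def)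
next
  fix v assume v: "v \<in> free_space (topspace X)"
  obtain s where s: "s > 0" "s *\<^sub>R v \<in> U" using U v unfolding free_disk_def by blast
  obtain t where t: "t > 0" "t *\<^sub>R v \<in> V" using V v unfolding free_disk_def by blast
  have "min s t *\<^sub>R v \<in> U"
    using free_disk_scale1[OF U s(2), of "min s t / s"] s(1) t(1) by simp
  moreover have "min s t *\<^sub>R v \<in> V"
    using free_disk_scale1[OF V t(2), of "min s t / t"] s(1) t(1) by simp
  ultimately show "\<exists>t>0. t *\<^sub>R v \<in> U \<inter> V" using s t by (intro exI[of _ "min s t"]) auto
next
  fix x c assume x: "x \<in> topspace X"
  obtain G where G: "openin X G" "x \<in> G" "\<forall>y\<in>G. c *\<^sub>R (delta y - delta x) \<in> U"
    using U x unfolding free_disk_def by blast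
  obtain H where H: "openin X H" "x \<in> H" "\<forall>y\<in>H. c *\<^sub>R (delta y - delta x) \<in> V"
    using V x unfolding free_disk_def by blast
  show "\<exists>G. openin X G \<and> x \<in> G \<and> (\<forall>y\<in>G. c *\<^sub>R (delta y - delta x) \<in> U \<inter> V)"
    using G H by (intro exI[of _ "G \<inter> H"]) auto
qed

lemma free_disk_scale:
  assumes U: "free_disk X U" and c: "c > 0"
  shows "free_disk X {v. c *\<^sub>R v \<in> U}"
  unfolding free_disk_def
proof (intro conjI ballI allI)
  show "{v. c *\<^sub>R v \<in> U} \<subseteq> free_space (topspace X)"
  proof safe
    fix v assume "c *\<^sub>R v \<in> U"
    then have "(1/c) *\<^sub>R (c *\<^sub>R v) \<in> free_space (topspace X)"
      using U subspace_free_space by (metis free_disk_def subsetD subspace_scale)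
    then show "v \<in> free_space (topspace X)" using c by simp
  qed
  show "convex {v. c *\<^sub>R v \<in> U}"
  proof (rule convexI)
    fix x y :: "('a \<Rightarrow>\<^sub>0 real)" and a b :: real
    assume *: "x \<in> {v. c *\<^sub>R v \<in> U}" "y \<in> {v. c *\<^sub>R v \<in> U}" "0 \<le> a" "0 \<le> b" "a + b = 1"
    have "a *\<^sub>R (c *\<^sub>R x) + b *\<^sub>R (c *\<^sub>R y) \<in> U"
      using U * by (intro convexD) (auto simp: free_disk_def)
    then show "a *\<^sub>R x + b *\<^sub>R y \<in> {v. c *\<^sub>R v \<in> U}"
      by (simp add: scaleR_add_right mult.commute)
  qed
  show "0 \<in> {v. c *\<^sub>R v \<in> U}" using U by (simp add: free_disk_def)
  fix u assume "u \<in> {v. c *\<^sub>R v \<in> U}"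
  then show "- u \<in> {v. c *\<^sub>R v \<in> U}" using U by (simp add: free_disk_def)
next
  fix v assume v: "v \<in> free_space (topspace X)"
  obtain s where s: "s > 0" "s *\<^sub>R v \<in> U" using U v unfolding free_disk_def by blast
  then show "\<exists>t>0. t *\<^sub>R v \<in> {v. c *\<^sub>R v \<in> U}" using c by (intro exI[of _ "s / c"]) simp
next
  fix x d assume x: "x \<in> topspace X"
  obtain G where "openin X G" "x \<in> G" "\<forall>y\<in>G. (c * d) *\<^sub>R (delta y - delta x) \<in> U"
    using U x unfolding free_disk_def by blast
  then show "\<exists>G. openin X G \<and> x \<in> G \<and> (\<forall>y\<in>G. d *\<^sub>R (delta y - delta x) \<in> {v. c *\<^sub>R v \<in> U})"
    by auto
qed

lemma free_disk_preimage:
  assumes E: "lcs E" and f: "continuous_map X E f"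
    and V: "convex V" "\<forall>v\<in>V. - v \<in> V" "openin E G" "0 \<in> G" "G \<subseteq> V"
  shows "free_disk X {p \<in> free_space (topspace X). free_extend f p \<in> V}" (is "free_disk X ?U")
proof -
  interpret f: linear "free_extend f" by (rule linear_free_extend)
  have fE: "f x \<in> topspace E" if "x \<in> topspace X" for x
    using f that by (auto simp: continuous_map_def)
  note sub = subspace_free_space[of "topspace X"]
  have V0: "0 \<in> V" using V by blast
  show ?thesis
    unfolding free_disk_def
  proof (intro conjI ballI allI)
    show "?U \<subseteq> free_space (topspace X)" by blast
    have "?U = free_space (topspace X) \<inter> free_extend f -` V" by auto
    then show "convex ?U"
      using convex_Int[OF subspace_imp_convex[OF sub] convex_linear_vimage[OF linear_free_extend V(1)]]
      by simp
    show "0 \<in> ?U" using V0 sub by (simp add: f.zero subspace_0)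
    fix u assume "u \<in> ?U" then show "- u \<in> ?U" using V(2) sub by (simp add: f.neg subspace_neg)
  next
    fix v assume v: "v \<in> free_space (topspace X)"
    let ?w = "free_extend f v"
    have w: "?w \<in> topspace E" using free_extend_mem[OF lcs_subspace[OF E] fE v] .
    have c: "continuous_map euclideanreal E ((\<lambda>(c, y). c *\<^sub>R y) \<circ> (\<lambda>c. (c, ?w)))"
      using E w by (intro continuous_map_compose[where X'="prod_topology euclideanreal E"])
        (auto simp: lcs_def continuous_map_pairedI)
    have "open {c. c *\<^sub>R ?w \<in> G}"
      using openin_continuous_map_preimage[OF c V(3)] by simp
    moreover have "0 \<in> {c. c *\<^sub>R ?w \<in> G}" using V(4) by simp
    ultimately obtain e where e: "e > 0" "cball 0 e \<subseteq> {c. c *\<^sub>R ?w \<in> G}"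
      using open_contains_cball by blast
    then have "e \<in> {c. c *\<^sub>R ?w \<in> G}" by (intro subsetD[OF e(2)]) simp
    then have "e *\<^sub>R ?w \<in> V" using V(5) by blast
    then show "\<exists>t>0. t *\<^sub>R v \<in> ?U"
      using e(1) v sub by (intro exI[of _ e]) (simp add: f.scaleR subspace_scale)
  next
    fix x c assume x: "x \<in> topspace X"
    let ?G = "{u \<in> topspace E. c *\<^sub>R u \<in> G}"
    define H where "H = {y \<in> topspace X. f y - f x \<in> ?G}"
    have E1: "continuous_map E E ((\<lambda>(a, y). a + y) \<circ> (\<lambda>u. (u, - f x)))"
      using E fE[OF x] lcs_subspace[OF E]
      by (intro continuous_map_compose[where X'="prod_topology E E"])
        (auto simp: lcs_def continuous_map_pairedI subspace_neg)
    have "openin X {y \<in> topspace X. (((\<lambda>(a, y). a + y) \<circ> (\<lambda>u. (u, - f x))) \<circ> f) y \<in> ?G}"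
      by (rule openin_continuous_map_preimage[OF continuous_map_compose[OF f E1] lcs_scale[OF E V(3)]])
    then have "openin X H" by (simp add: H_def)
    moreover have "x \<in> H" using x V(4) lcs_subspace[OF E] by (simp add: H_def subspace_0)
    moreover have "c *\<^sub>R (delta y - delta x) \<in> ?U" if "y \<in> H" for y
    proof -
      have "c *\<^sub>R (delta y - delta x) \<in> free_space (topspace X)"
        using that x sub by (intro subspace_scale subspace_diff) (auto simp: H_def)
      moreover have "free_extend f (c *\<^sub>R (delta y - delta x)) \<in> V"
        using that V(5) by (auto simp: H_def f.scaleR f.diff)
      ultimately show ?thesis by blast
    qed
    ultimately show "\<exists>G. openin X G \<and> x \<in> G \<and> (\<forall>y\<in>G. c *\<^sub>R (delta y - delta x) \<in> ?U)"
      by blast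
  qed
qed

lemma lcs_euclideanreal: "lcs euclideanreal"
  unfolding lcs_def
proof (intro conjI)
  show "continuous_map (prod_topology euclideanreal euclideanreal) euclideanreal (\<lambda>(x, y). x + y)"
    by (simp add: case_prod_unfold continuous_map_iff_continuous2 continuous_intros
        flip: euclidean_product_topology)
  show "continuous_map (prod_topology euclideanreal euclideanreal) euclideanreal (\<lambda>(c, x). c *\<^sub>R x)"
    by (simp add: case_prod_unfold continuous_map_iff_continuous2 continuous_intros
        flip: euclidean_product_topology)
  show "neighbourhood_base_at 0 convex euclideanreal"
    unfolding neighbourhood_base_at_def
    by (metis convex_ball centre_in_ball open_ball open_openin openE order_refl)
qed auto

lemma free_disk_UNIV: "free_disk X (free_space (topspace X))"
  unfolding free_disk_def
proof (intro conjI ballI allI)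
  note sub = subspace_free_space[of "topspace X"]
  show "convex (free_space (topspace X))" "0 \<in> free_space (topspace X)"
    using sub by (simp_all add: subspace_imp_convex subspace_0)
  show "- u \<in> free_space (topspace X)" if "u \<in> free_space (topspace X)" for u
    using that sub by (simp add: subspace_neg)
  show "\<exists>t>0. t *\<^sub>R v \<in> free_space (topspace X)" if "v \<in> free_space (topspace X)" for v
    using that by (intro exI[of _ 1]) auto
  show "\<exists>G. openin X G \<and> x \<in> G \<and> (\<forall>y\<in>G. c *\<^sub>R (delta y - delta x) \<in> free_space (topspace X))"
    if "x \<in> topspace X" for x c
    using that sub by (intro exI[of _ "topspace X"]) (auto intro!: subspace_scale subspace_diff)
qed auto

lemma openin_free_topology:
  "openin (free_topology X) W \<longleftrightarrow> W \<subseteq> free_space (topspace X) \<and>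
     (\<forall>w\<in>W. \<exists>U. free_disk X U \<and> (\<forall>u\<in>U. w + u \<in> W))"
proof -
  have "istopology (\<lambda>W. W \<subseteq> free_space (topspace X) \<and>
     (\<forall>w\<in>W. \<exists>U. free_disk X U \<and> (\<forall>u\<in>U. w + u \<in> W)))"
    unfolding istopology_def
  proof (intro conjI allI impI ballI)
    fix S T w
    assume S: "S \<subseteq> free_space (topspace X) \<and> (\<forall>w\<in>S. \<exists>U. free_disk X U \<and> (\<forall>u\<in>U. w + u \<in> S))"
      and T: "T \<subseteq> free_space (topspace X) \<and> (\<forall>w\<in>T. \<exists>U. free_disk X U \<and> (\<forall>u\<in>U. w + u \<in> T))"
      and w: "w \<in> S \<inter> T"
    obtain U where "free_disk X U" "\<forall>u\<in>U. w + u \<in> S" using S w by blast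
    moreover obtain V where "free_disk X V" "\<forall>u\<in>V. w + u \<in> T" using T w by blast
    ultimately show "\<exists>U. free_disk X U \<and> (\<forall>u\<in>U. w + u \<in> S \<inter> T)"
      using free_disk_Int by (intro exI[of _ "U \<inter> V"]) auto
  next
    fix K w
    assume "\<forall>W\<in>K. W \<subseteq> free_space (topspace X) \<and> (\<forall>w\<in>W. \<exists>U. free_disk X U \<and> (\<forall>u\<in>U. w + u \<in> W))"
      and "w \<in> \<Union>K"
    then show "\<exists>U. free_disk X U \<and> (\<forall>u\<in>U. w + u \<in> \<Union>K)" by (meson UnionE UnionI)
  qed auto
  then show ?thesis unfolding free_topology_def by (rule fun_cong[OF topology_inverse'])
qed

lemma topspace_free_topology [simp]: "topspace (free_topology X) = free_space (topspace X)"
proof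
  show "topspace (free_topology X) \<subseteq> free_space (topspace X)"
    using openin_topspace[of "free_topology X"] unfolding openin_free_topology by blast
  have "openin (free_topology X) (free_space (topspace X))"
    unfolding openin_free_topology
    using free_disk_UNIV subspace_add[OF subspace_free_space] by blast
  then show "free_space (topspace X) \<subseteq> topspace (free_topology X)" by (rule openin_subset)
qed

lemma free_disk_open:
  assumes U: "free_disk X U"
  shows "\<exists>N. openin (free_topology X) N \<and> 0 \<in> N \<and> N \<subseteq> U"
proof -
  let ?N = "{v. \<exists>e>0. \<forall>u\<in>U. v + e *\<^sub>R u \<in> U}"
  have sub: "?N \<subseteq> U" using U by (force simp: free_disk_def)
  have "0 \<in> ?N" by (auto intro!: exI[of _ 1])
  moreover have "openin (free_topology X) ?N"
    unfolding openin_free_topology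
  proof (intro conjI ballI)
    show "?N \<subseteq> free_space (topspace X)" using sub U by (auto simp: free_disk_def)
    fix v assume "v \<in> ?N"
    then obtain e where e: "e > 0" "\<forall>u\<in>U. v + e *\<^sub>R u \<in> U" by blast
    have "v + w \<in> ?N" if w: "(2 / e) *\<^sub>R w \<in> U" for w
    proof -
      have "v + w + (e / 2) *\<^sub>R u \<in> U" if u: "u \<in> U" for u
      proof -
        have "(1/2) *\<^sub>R ((2 / e) *\<^sub>R w) + (1/2) *\<^sub>R u \<in> U"
          using w u U by (intro convexD) (auto simp: free_disk_def)
        then have "v + e *\<^sub>R ((1/2) *\<^sub>R ((2 / e) *\<^sub>R w) + (1/2) *\<^sub>R u) \<in> U" using e(2) by blast
        then show ?thesis using e(1) by (simp add: scaleR_add_right add.assoc)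
      qed
      then show ?thesis using e(1) by (auto intro!: exI[of _ "e / 2"])
    qed
    then show "\<exists>U. free_disk X U \<and> (\<forall>u\<in>U. v + u \<in> ?N)"
      using free_disk_scale[OF U, of "2 / e"] e(1)
      by (intro exI[of _ "{w. (2 / e) *\<^sub>R w \<in> U}"]) auto
  qed
  ultimately show ?thesis using sub by blast
qed

lemma free_disk_open_at:
  assumes U: "free_disk X U" and v: "v \<in> free_space (topspace X)"
  shows "\<exists>N. openin (free_topology X) N \<and> v \<in> N \<and> (\<forall>w\<in>N. w - v \<in> U)"
proof -
  obtain N where N: "openin (free_topology X) N" "0 \<in> N" "N \<subseteq> U" using free_disk_open[OF U] by blast
  have "openin (free_topology X) ((+) v ` N)"
    unfolding openin_free_topology
  proof (intro conjI ballI)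
    show "(+) v ` N \<subseteq> free_space (topspace X)"
      using N(1) v subspace_add[OF subspace_free_space] unfolding openin_free_topology by blast
    fix w assume "w \<in> (+) v ` N"
    then obtain n where n: "n \<in> N" "w = v + n" by blast
    then obtain U where "free_disk X U" "\<forall>u\<in>U. n + u \<in> N" using N(1) by (auto simp: openin_free_topology)
    then show "\<exists>U. free_disk X U \<and> (\<forall>u\<in>U. w + u \<in> (+) v ` N)" using n(2) by (auto simp: add.assoc)
  qed
  then show ?thesis using N by (intro exI[of _ "(+) v ` N"]) (auto simp: image_iff)
qed

lemma lcs_free_topology:
  assumes X: "tychonoff_space X" shows "lcs (free_topology X)"
  unfolding lcs_def
proof (intro conjI)
  let ?F = "free_topology X" and ?V = "free_space (topspace X)"
  note sub = subspace_free_space[of "topspace X"]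
  show "subspace (topspace ?F)" by (simp add: subspace_free_space)
  show "neighbourhood_base_at 0 convex ?F"
    unfolding neighbourhood_base_at_def
  proof (intro allI impI)
    fix W assume W: "openin ?F W \<and> 0 \<in> W"
    then obtain U where U: "free_disk X U" "\<forall>u\<in>U. 0 + u \<in> W" unfolding openin_free_topology by blast
    obtain N where "openin ?F N" "0 \<in> N" "N \<subseteq> U" using free_disk_open[OF U(1)] by blast
    then show "\<exists>N V. openin ?F N \<and> convex V \<and> 0 \<in> N \<and> N \<subseteq> V \<and> V \<subseteq> W"
      using U by (intro exI[of _ N] exI[of _ U]) (auto simp: free_disk_def)
  qed
  show "continuous_map (prod_topology ?F ?F) ?F (\<lambda>(x, y). x + y)"
    unfolding continuous_map_def
  proof (intro conjI allI impI)
    show "(\<lambda>(x, y). x + y) \<in> topspace (prod_topology ?F ?F) \<rightarrow> topspace ?F"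
      using sub by (auto simp: subspace_add)
    fix W assume W: "openin ?F W"
    show "openin (prod_topology ?F ?F) {z \<in> topspace (prod_topology ?F ?F). (\<lambda>(x, y). x + y) z \<in> W}"
      unfolding openin_prod_topology_alt
    proof (intro allI impI)
      fix x y assume "(x, y) \<in> {z \<in> topspace (prod_topology ?F ?F). (\<lambda>(x, y). x + y) z \<in> W}"
      then have xy: "x \<in> ?V" "y \<in> ?V" "x + y \<in> W" by auto
      obtain U where U: "free_disk X U" "\<forall>u\<in>U. x + y + u \<in> W"
        using W xy(3) unfolding openin_free_topology by blast
      let ?U = "{u. 2 *\<^sub>R u \<in> U}"
      have U2: "free_disk X ?U" using free_disk_scale[OF U(1), of 2] by simp
      obtain M where M: "openin ?F M" "x \<in> M" "\<forall>w\<in>M. w - x \<in> ?U"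
        using free_disk_open_at[OF U2 xy(1)] by blast
      obtain N where N: "openin ?F N" "y \<in> N" "\<forall>w\<in>N. w - y \<in> ?U"
        using free_disk_open_at[OF U2 xy(2)] by blast
      have "a + b \<in> W" if "a \<in> M" "b \<in> N" for a b
      proof -
        have "(a - x) + (b - y) \<in> U" using free_disk_half[OF U(1)] M(3) N(3) that by blast
        then have "x + y + ((a - x) + (b - y)) \<in> W" using U(2) by blast
        then show ?thesis by simp
      qed
      moreover have "M \<subseteq> topspace ?F" "N \<subseteq> topspace ?F" using openin_subset[OF M(1)] openin_subset[OF N(1)] by auto
      ultimately show "\<exists>M N. openin ?F M \<and> openin ?F N \<and> x \<in> M \<and> y \<in> N \<and>
          M \<times> N \<subseteq> {z \<in> topspace (prod_topology ?F ?F). (\<lambda>(x, y). x + y) z \<in> W}"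
        using M N by (intro exI[of _ M] exI[of _ N]) auto
    qed
  qed
  show "continuous_map (prod_topology euclideanreal ?F) ?F (\<lambda>(c, x). c *\<^sub>R x)"
    unfolding continuous_map_def
  proof (intro conjI allI impI)
    show "(\<lambda>(c, x). c *\<^sub>R x) \<in> topspace (prod_topology euclideanreal ?F) \<rightarrow> topspace ?F"
      using sub by (auto simp: subspace_scale)
    fix W assume W: "openin ?F W"
    show "openin (prod_topology euclideanreal ?F)
        {z \<in> topspace (prod_topology euclideanreal ?F). (\<lambda>(c, x). c *\<^sub>R x) z \<in> W}"
      unfolding openin_prod_topology_alt
    proof (intro allI impI)
      fix c x assume "(c, x) \<in> {z \<in> topspace (prod_topology euclideanreal ?F). (\<lambda>(c, x). c *\<^sub>R x) z \<in> W}"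
      then have cx: "x \<in> ?V" "c *\<^sub>R x \<in> W" by auto
      obtain U where U: "free_disk X U" "\<forall>u\<in>U. c *\<^sub>R x + u \<in> W"
        using W cx(2) unfolding openin_free_topology by blast
      obtain t where t: "t > 0" "t *\<^sub>R x \<in> U" using U(1) cx(1) unfolding free_disk_def by blast
      define m where "m = 2 * (\<bar>c\<bar> + t)"
      have m: "m > 0" using t by (simp add: m_def)
      obtain N where N: "openin ?F N" "x \<in> N" "\<forall>w\<in>N. w - x \<in> {u. m *\<^sub>R u \<in> U}"
        using free_disk_open_at[OF free_disk_scale[OF U(1) m] cx(1)] by blast
      have "d *\<^sub>R y \<in> W" if d: "d \<in> ball c (t / 2)" and y: "y \<in> N" for d y
      proof -
        have dc: "\<bar>d - c\<bar> < t / 2" using d by (simp add: dist_real_def abs_minus_commute)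
        have "\<bar>2 * (d - c)\<bar> \<le> t" using dc by argo
        then have "\<bar>2 * (d - c) / t\<bar> \<le> 1" using t(1) by (simp only: abs_divide abs_of_pos divide_le_eq_1_pos)
        then have "(2 * (d - c) / t) *\<^sub>R (t *\<^sub>R x) \<in> U" by (rule free_disk_scale1[OF U(1) t(2)])
        then have 1: "2 *\<^sub>R ((d - c) *\<^sub>R x) \<in> U" using t(1) by simp
        have "\<bar>2 * d\<bar> \<le> m" using dc t(1) unfolding m_def by argo
        then have "\<bar>2 * d / m\<bar> \<le> 1" using m by (simp only: abs_divide abs_of_pos divide_le_eq_1_pos)
        moreover have "m *\<^sub>R (y - x) \<in> U" using N(3) y by blast
        ultimately have "(2 * d / m) *\<^sub>R (m *\<^sub>R (y - x)) \<in> U"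
          using free_disk_scale1[OF U(1)] by blast
        then have 2: "2 *\<^sub>R (d *\<^sub>R (y - x)) \<in> U" using m by simp
        have "c *\<^sub>R x + ((d - c) *\<^sub>R x + d *\<^sub>R (y - x)) \<in> W"
          using free_disk_half[OF U(1) 1 2] U(2) by blast
        then show ?thesis by (simp add: algebra_simps)
      qed
      moreover have "N \<subseteq> topspace ?F" using openin_subset[OF N(1)] by auto
      ultimately show "\<exists>M N. openin euclideanreal M \<and> openin ?F N \<and> c \<in> M \<and> x \<in> N \<and>
          M \<times> N \<subseteq> {z \<in> topspace (prod_topology euclideanreal ?F). (\<lambda>(c, x). c *\<^sub>R x) z \<in> W}"
        using N t(1) by (intro exI[of _ "ball c (t / 2)"] exI[of _ N]) auto
    qed
  qed
  show "Hausdorff_space ?F"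
    unfolding Hausdorff_space_def
  proof (intro allI impI)
    fix p q assume "p \<in> topspace ?F \<and> q \<in> topspace ?F \<and> p \<noteq> q"
    then have pq: "p \<in> ?V" "q \<in> ?V" "p \<noteq> q" by auto
    let ?r = "p - q"
    have r: "?r \<in> ?V" using pq sub by (simp add: subspace_diff)
    obtain z where z: "Poly_Mapping.lookup ?r z \<noteq> 0"
      using pq(3) by (metis eq_iff_diff_eq_0 lookup_zero poly_mapping_eqI)
    then have zk: "z \<in> Poly_Mapping.keys ?r" by (simp add: in_keys_iff)
    let ?S = "Poly_Mapping.keys ?r - {z}"
    have kX: "Poly_Mapping.keys ?r \<subseteq> topspace X" using r by (simp add: free_space_def)
    have cl: "closedin X ?S"
      using X kX by (intro closedin_Hausdorff_finite) (auto simp: tychonoff_space_def)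
    have "z \<in> topspace X - ?S" using kX zk by blast
    then obtain g where g0: "continuous_map X (top_of_set {0..1::real}) g" "g z = 0" "g ` ?S \<subseteq> {1}"
      using X cl unfolding tychonoff_space_def completely_regular_space_def by metis
    then have g: "continuous_map X euclideanreal g" "g z = 0" "g ` ?S \<subseteq> {1}"
      by (auto dest: continuous_map_into_fulltopology)
    let ?f = "\<lambda>x. 1 - g x"
    have f: "continuous_map X euclideanreal ?f" using g(1) by (intro continuous_intros)
    interpret f: linear "free_extend ?f" by (rule linear_free_extend)
    let ?a = "Poly_Mapping.lookup ?r z"
    have "free_extend ?f ?r = (\<Sum>x\<in>{z}. Poly_Mapping.lookup ?r x *\<^sub>R ?f x)"
      unfolding free_extend_def using zk g(3) by (intro sum.mono_neutral_right) auto
    then have fr: "free_extend ?f ?r = ?a" using g(2) by simp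
    let ?U = "{p \<in> ?V. free_extend ?f p \<in> ball 0 (\<bar>?a\<bar> / 2)}"
    have U: "free_disk X ?U"
      using z by (intro free_disk_preimage[OF lcs_euclideanreal f, where G="ball 0 (\<bar>?a\<bar> / 2)"]) auto
    obtain M where M: "openin ?F M" "p \<in> M" "\<forall>w\<in>M. w - p \<in> ?U"
      using free_disk_open_at[OF U pq(1)] by blast
    obtain N where N: "openin ?F N" "q \<in> N" "\<forall>w\<in>N. w - q \<in> ?U"
      using free_disk_open_at[OF U pq(2)] by blast
    have "disjnt M N"
      unfolding disjnt_iff
    proof (intro allI notI)
      fix w assume w: "w \<in> M \<and> w \<in> N"
      have "\<bar>free_extend ?f (w - p)\<bar> < \<bar>?a\<bar> / 2" "\<bar>free_extend ?f (w - q)\<bar> < \<bar>?a\<bar> / 2"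
        using w M(3) N(3) by auto
      moreover have "?a = free_extend ?f (w - q) - free_extend ?f (w - p)"
        using fr by (simp add: f.diff)
      ultimately show False by linarith
    qed
    then show "\<exists>M N. openin ?F M \<and> openin ?F N \<and> p \<in> M \<and> q \<in> N \<and> disjnt M N"
      using M N by blast
  qed
qed

lemma continuous_map_delta: "continuous_map X (free_topology X) delta"
  unfolding continuous_map_def
proof (intro conjI allI impI)
  show "delta \<in> topspace X \<rightarrow> topspace (free_topology X)" by auto
  fix W assume W: "openin (free_topology X) W"
  show "openin X {x \<in> topspace X. delta x \<in> W}"
  proof (subst openin_subopen, intro ballI)
    fix x assume x: "x \<in> {x \<in> topspace X. delta x \<in> W}"
    then obtain U where U: "free_disk X U" "\<forall>u\<in>U. delta x + u \<in> W"
      using W unfolding openin_free_topology by blast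
    then obtain G where G: "openin X G" "x \<in> G" "\<forall>y\<in>G. 1 *\<^sub>R (delta y - delta x) \<in> U"
      using x unfolding free_disk_def by blast
    have "delta y \<in> W" if "y \<in> G" for y
    proof -
      have "delta x + 1 *\<^sub>R (delta y - delta x) \<in> W" using U(2) G(3) that by blast
      then show ?thesis by simp
    qed
    then show "\<exists>T. openin X T \<and> x \<in> T \<and> T \<subseteq> {x \<in> topspace X. delta x \<in> W}"
      using G(1,2) openin_subset[OF G(1)] by (intro exI[of _ G]) auto
  qed
qed

lemma free_topology_universal:
  fixes E :: "'e::real_vector topology"
  assumes E: "lcs E"
  shows "extends_uniquely X (free_topology X) delta E"
  unfolding extends_uniquely_def
proof (intro allI impI)
  fix f assume f: "continuous_map X E f"
  let ?V = "free_space (topspace X)"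
  note sub = subspace_free_space[of "topspace X"]
  interpret f: linear "free_extend f" by (rule linear_free_extend)
  have fE: "f x \<in> topspace E" if "x \<in> topspace X" for x
    using f that by (auto simp: continuous_map_def)
  let ?g = "restrict (free_extend f) ?V"
  have "continuous_map (free_topology X) E (free_extend f)"
    unfolding continuous_map_def
  proof (intro conjI allI impI)
    show "free_extend f \<in> topspace (free_topology X) \<rightarrow> topspace E"
      using free_extend_mem[OF lcs_subspace[OF E] fE] by auto
    fix W assume W: "openin E W"
    show "openin (free_topology X) {p \<in> topspace (free_topology X). free_extend f p \<in> W}"
      unfolding openin_free_topology
    proof (intro conjI ballI)
      fix w assume w: "w \<in> {p \<in> topspace (free_topology X). free_extend f p \<in> W}"
      obtain G where G: "openin E G" "0 \<in> G" "\<forall>u\<in>G. free_extend f w + u \<in> W"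
        using lcs_translate[OF E W] w by blast
      obtain D H where D: "convex D" "\<forall>v\<in>D. - v \<in> D" "D \<subseteq> G" "openin E H" "0 \<in> H" "H \<subseteq> D"
        using lcs_disk[OF E G(1,2)] by blast
      show "\<exists>U. free_disk X U \<and> (\<forall>u\<in>U. w + u \<in> {p \<in> topspace (free_topology X). free_extend f p \<in> W})"
        using free_disk_preimage[OF E f D(1,2,4-6)] w G(3) D(3) sub
        by (intro exI[of _ "{p \<in> ?V. free_extend f p \<in> D}"]) (auto simp: f.add subspace_add)
    qed auto
  qed
  then have "continuous_map (free_topology X) E ?g" by (rule continuous_map_eq) simp
  moreover have "linear_map_on ?V ?g"
    using sub by (simp add: linear_map_on_def f.add f.scaleR subspace_add subspace_scale)
  ultimately have g: "?g \<in> continuous_operators (free_topology X) E \<and> (\<forall>x\<in>topspace X. ?g (delta x) = f x)"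
    by (simp add: continuous_operators_def)
  show "\<exists>!g. g \<in> continuous_operators (free_topology X) E \<and> (\<forall>x\<in>topspace X. g (delta x) = f x)"
  proof (rule ex1I, rule g)
    fix h assume h: "h \<in> continuous_operators (free_topology X) E \<and> (\<forall>x\<in>topspace X. h (delta x) = f x)"
    show "h = ?g"
    proof (rule extensionalityI[of _ ?V])
      fix p assume p: "p \<in> ?V"
      have "h p = free_extend (\<lambda>x. h (delta x)) p"
        using h p by (intro linear_map_on_free_space) (auto simp: continuous_operators_def)
      also have "\<dots> = free_extend f p"
        using h p by (auto simp: free_extend_def free_space_def intro!: sum.cong)
      finally show "h p = ?g p" using p by simp
    qed (use h in \<open>auto simp: continuous_operators_def\<close>)
  qed
qed

theorem free_lcs_exists:
  "tychonoff_space X \<Longrightarrow> free_lcs X (free_topology X) delta"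
  by (simp add: free_lcs_def lcs_free_topology continuous_map_delta free_topology_universal)

theorem free_lcs_universal:
  fixes L :: "'l::real_vector topology" and E :: "'e::real_vector topology"
  assumes X: "tychonoff_space X" and L: "free_lcs X L i" and E: "lcs E"
  shows "extends_uniquely X L i E"
proof -
  let ?F = "free_topology X"
  have lcsL: "lcs L" and i: "continuous_map X L i" and LL: "extends_uniquely X L i L"
    using L by (auto simp: free_lcs_def)
  note FX = lcs_free_topology[OF X]
  have LF: "extends_uniquely X L i ?F" using L FX by (simp add: free_lcs_def)
  obtain a where a: "a \<in> continuous_operators L ?F" "\<forall>x\<in>topspace X. a (i x) = delta x"
    using LF continuous_map_delta unfolding extends_uniquely_def by blast
  obtain b where b: "b \<in> continuous_operators ?F L" "\<forall>x\<in>topspace X. b (delta x) = i x"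
    using free_topology_universal[OF lcsL, of X] i unfolding extends_uniquely_def by blast
  have iL: "i x \<in> topspace L" if "x \<in> topspace X" for x
    using i that by (auto simp: continuous_map_def)
  have aF: "a v \<in> topspace ?F" if "v \<in> topspace L" for v
    using a(1) that by (auto simp: continuous_operators_def continuous_map_def)
  have id: "restrict (\<lambda>v. v) (topspace L) \<in> continuous_operators L L"
    using lcs_subspace[OF lcsL]
    by (auto simp: continuous_operators_def linear_map_on_def subspace_add subspace_scale
        intro: continuous_map_eq[OF continuous_map_id])
  have comp: "restrict (\<lambda>v. b (a v)) (topspace L) \<in> continuous_operators L L"
    by (rule continuous_operators_compose[OF lcs_subspace[OF lcsL] a(1) b(1)])
  have "\<exists>!g. g \<in> continuous_operators L L \<and> (\<forall>x\<in>topspace X. g (i x) = i x)"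
    using LL i unfolding extends_uniquely_def by blast
  then have uniq: "h = k" if "h \<in> continuous_operators L L" "\<forall>x\<in>topspace X. h (i x) = i x"
      "k \<in> continuous_operators L L" "\<forall>x\<in>topspace X. k (i x) = i x" for h k
    using that by blast
  have "restrict (\<lambda>v. b (a v)) (topspace L) = restrict (\<lambda>v. v) (topspace L)"
    using a(2) b(2) iL by (intro uniq id comp) auto
  then have ba: "b (a v) = v" if "v \<in> topspace L" for v
    using that by (metis restrict_apply')
  show ?thesis
    unfolding extends_uniquely_def
  proof (intro allI impI)
    fix f assume f: "continuous_map X E f"
    have ex: "\<exists>!g. g \<in> continuous_operators ?F E \<and> (\<forall>x\<in>topspace X. g (delta x) = f x)"
      using free_topology_universal[OF E, of X] f unfolding extends_uniquely_def by simp
    then obtain g where g: "g \<in> continuous_operators ?F E" "\<forall>x\<in>topspace X. g (delta x) = f x"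
      by blast
    have gu: "h = g" if "h \<in> continuous_operators ?F E" "\<forall>x\<in>topspace X. h (delta x) = f x" for h
      using ex g that by blast
    show "\<exists>!h. h \<in> continuous_operators L E \<and> (\<forall>x\<in>topspace X. h (i x) = f x)"
    proof (rule ex1I)
      show "restrict (\<lambda>v. g (a v)) (topspace L) \<in> continuous_operators L E \<and>
          (\<forall>x\<in>topspace X. restrict (\<lambda>v. g (a v)) (topspace L) (i x) = f x)"
        using continuous_operators_compose[OF lcs_subspace[OF lcsL] a(1) g(1)] a(2) g(2) iL by simp
    next
      fix h assume h: "h \<in> continuous_operators L E \<and> (\<forall>x\<in>topspace X. h (i x) = f x)"
      have hb: "restrict (\<lambda>v. h (b v)) (topspace ?F) = g"
        using continuous_operators_compose[OF lcs_subspace[OF FX] b(1)] h b(2) by (intro gu) auto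
      show "h = restrict (\<lambda>v. g (a v)) (topspace L)"
      proof (rule extensionalityI[of _ "topspace L"])
        fix v assume v: "v \<in> topspace L"
        have "g (a v) = h (b (a v))" using hb aF[OF v] by (metis restrict_apply')
        then show "h v = restrict (\<lambda>v. g (a v)) (topspace L) v" using v ba by simp
      qed (use h in \<open>auto simp: continuous_operators_def\<close>)
    qed
  qed
qed

end

theory Submission
  imports Defs
begin

text \<open>A strongly null sequence \<open>\<phi>\<close> in the dual of \<open>L\<close> restricts along \<open>i\<close> to a sequence of continuous
  functions \<open>\<phi> n \<circ> i\<close> on \<open>X\<close>. Compact sets of \<open>X\<close> have compact, hence bounded, images in \<open>L\<close>
  (\<open>compactin_imp_lcs_bounded\<close>), so this sequence tends to zero uniformly on compact sets, that is,
  in the compact-open topology; the sequential Ascoli property makes it equicontinuous.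

  Equicontinuity on \<open>X\<close> is then transported to \<open>L\<close> by the universal property
  (\<open>equicontinuous_functionals_free_lcs\<close>): a pointwise bounded equicontinuous sequence on \<open>X\<close> is the
  same as one continuous map \<open>x \<mapsto> (\<phi> n (i x))\<^sub>n\<close> into the Banach space of bounded sequences. This map
  extends to a continuous operator \<open>g\<close> on \<open>L\<close>, uniqueness of extensions shows that the coordinates
  of \<open>g\<close> are the functionals \<open>\<phi> n\<close>, and so the preimage under \<open>g\<close> of the unit ball is a
  neighbourhood of zero on which all \<open>\<phi> n\<close> are at most one in modulus.\<close>

section \<open>Bounded sets and strong convergence\<close>

lemma zero_in_topspace_lcs: "lcs E \<Longrightarrow> 0 \<in> topspace E"
  using lcs_subspace subspace_0 by blast

text \<open>The dilations of an absolutely convex neighbourhood \<open>V\<close> of zero increase, and their interiors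
  cover the whole space because every vector scaled by \<open>1 / n\<close> tends to zero. So a compact set lies
  in one of them. The sets \<open>D n\<close> are open parts of these dilations.\<close>

lemma compactin_imp_lcs_bounded:
  assumes E: "lcs E" and K: "compactin E K"
  shows "lcs_bounded E K"
  unfolding lcs_bounded_def
proof (intro conjI allI impI)
  show "K \<subseteq> topspace E" using K by (rule compactin_subset_topspace)
  fix U assume "zero_nbhd E U"
  then obtain W where W: "openin E W" "0 \<in> W" "W \<subseteq> U" unfolding zero_nbhd_def by blast
  obtain V G where V: "convex V" "\<forall>v\<in>V. - v \<in> V" "V \<subseteq> W"
    and G: "openin E G" "0 \<in> G" "G \<subseteq> V"
    using lcs_disk[OF E W(1,2)] by blast
  define D where "D n = {u \<in> topspace E. (1 / real (Suc n)) *\<^sub>R u \<in> G}" for n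
  have D: "openin E (D n)" for n
    unfolding D_def by (rule lcs_scale[OF E G(1)])
  have "x \<in> \<Union>(range D)" if x: "x \<in> K" for x
  proof -
    have xE: "x \<in> topspace E" using x K compactin_subset_topspace by blast
    have c: "continuous_map euclideanreal E ((\<lambda>(c, y). c *\<^sub>R y) \<circ> (\<lambda>c. (c, x)))"
      using E xE by (intro continuous_map_compose[where X'="prod_topology euclideanreal E"])
        (auto simp: lcs_def continuous_map_pairedI)
    have "open {c. c *\<^sub>R x \<in> G}"
      using openin_continuous_map_preimage[OF c G(1)] by simp
    moreover have "0 \<in> {c. c *\<^sub>R x \<in> G}" using G(2) by simp
    moreover have "(\<lambda>n. 1 / real (Suc n)) \<longlonglongrightarrow> 0" by (rule LIMSEQ_Suc[OF lim_1_over_n])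
    ultimately have "eventually (\<lambda>n. 1 / real (Suc n) \<in> {c. c *\<^sub>R x \<in> G}) sequentially"
      using topological_tendstoD by blast
    then obtain n where "(1 / real (Suc n)) *\<^sub>R x \<in> G"
      by (auto simp: eventually_sequentially)
    then show ?thesis using xE by (auto simp: D_def)
  qed
  then have "\<exists>\<F>. finite \<F> \<and> \<F> \<subseteq> range D \<and> K \<subseteq> \<Union>\<F>"
    using D by (intro compactinD[OF K]) auto
  then obtain N where N: "finite N" "K \<subseteq> (\<Union>n\<in>N. D n)"
    by (metis finite_subset_image)
  define s where "s = real (Suc (Max (insert 0 N)))"
  have "K \<subseteq> (*\<^sub>R) t ` U" if t: "s \<le> \<bar>t\<bar>" for t
  proof
    fix x assume "x \<in> K"
    then obtain n where n: "n \<in> N" "(1 / real (Suc n)) *\<^sub>R x \<in> V"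
      using N(2) G(3) by (auto simp: D_def)
    have "n \<le> Max (insert 0 N)" using n(1) N(1) by simp
    then have nt: "real (Suc n) \<le> \<bar>t\<bar>" using t by (simp add: s_def)
    then have t0: "t \<noteq> 0" by auto
    have "\<bar>real (Suc n) / t\<bar> \<le> 1" using nt t0 by (simp add: divide_le_eq)
    moreover have "0 \<in> V" using G by blast
    ultimately have "(real (Suc n) / t) *\<^sub>R ((1 / real (Suc n)) *\<^sub>R x) \<in> V"
      using convex_sym_scale[OF V(1) _ V(2) n(2)] by blast
    then have "(1 / t) *\<^sub>R x \<in> U" using V(3) W(3) by auto
    then show "x \<in> (*\<^sub>R) t ` U" using t0 by (intro image_eqI[of _ _ "(1 / t) *\<^sub>R x"]) auto
  qed
  then show "\<exists>s>0. \<forall>t. s \<le> \<bar>t\<bar> \<longrightarrow> K \<subseteq> (*\<^sub>R) t ` U"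
    by (intro exI[of _ s]) (auto simp: s_def)
qed

lemma strong_limit_uniform_on_bounded:
  assumes lim: "limitin (strong_topology E) \<phi> \<psi> F" and B: "lcs_bounded E B" and e: "e > 0"
  shows "eventually (\<lambda>n. \<forall>x\<in>B. \<bar>\<phi> n x - \<psi> x\<bar> < e) F"
proof -
  \<comment> \<open>The strict inequality over \<open>B\<close> alone need not define an open set; a margin below \<open>e\<close> does.\<close>
  let ?W = "{\<xi> \<in> dual E. \<exists>r<e. \<forall>x\<in>B. \<bar>\<xi> x - \<psi> x\<bar> \<le> r}"
  have "openin (strong_topology E) ?W"
    unfolding openin_strong_topology
  proof (intro conjI ballI)
    fix \<xi> assume "\<xi> \<in> ?W"
    then obtain r where r: "r < e" "\<forall>x\<in>B. \<bar>\<xi> x - \<psi> x\<bar> \<le> r" by blast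
    define d where "d = (e - r) / 2"
    have d: "d > 0" "r + d < e" using r(1) by (auto simp: d_def field_simps)
    have "{\<eta> \<in> dual E. \<forall>x\<in>B. \<bar>\<eta> x - \<xi> x\<bar> < d} \<subseteq> ?W"
    proof safe
      fix \<eta> assume \<eta>: "\<forall>x\<in>B. \<bar>\<eta> x - \<xi> x\<bar> < d"
      have "\<bar>\<eta> x - \<psi> x\<bar> \<le> r + d" if "x \<in> B" for x
        using bspec[OF r(2) that] bspec[OF \<eta> that] by linarith
      then show "\<exists>r<e. \<forall>x\<in>B. \<bar>\<eta> x - \<psi> x\<bar> \<le> r" using d(2) by blast
    qed
    then show "\<exists>B e. lcs_bounded E B \<and> e > 0 \<and> {\<eta> \<in> dual E. \<forall>x\<in>B. \<bar>\<eta> x - \<xi> x\<bar> < e} \<subseteq> ?W"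
      using B d(1) by blast
  qed auto
  moreover have "\<psi> \<in> dual E"
    using limitin_topspace[OF lim] openin_topspace[of "strong_topology E"]
    unfolding openin_strong_topology by blast
  then have "\<psi> \<in> ?W" using e by (auto intro!: exI[of _ 0])
  ultimately have "eventually (\<lambda>n. \<phi> n \<in> ?W) F" using lim unfolding limitin_def by blast
  then show ?thesis by (rule eventually_mono) fastforce
qed

section \<open>Uniform convergence on compact sets\<close>

text \<open>Convergence needs to be tested on a subbase only, and for the subbasic set given by \<open>K\<close> and
  \<open>U\<close> the compact image \<open>g ` K\<close> keeps a positive distance from the complement of \<open>U\<close>.\<close>

lemma limitin_compact_open_topologyI:
  assumes f: "\<And>n. f n \<in> cont_funs X" and g: "g \<in> cont_funs X"
    and unif: "\<And>K e. compactin X K \<Longrightarrow> e > 0 \<Longrightarrow> eventually (\<lambda>n. \<forall>x\<in>K. \<bar>f n x - g x\<bar> < e) F"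
  shows "limitin (compact_open_topology X) f g F"
proof -
  let ?S = "{{f \<in> cont_funs X. f ` K \<subseteq> U} |K U. compactin X K \<and> open U}"
  have "eventually (\<lambda>n. f n \<in> T) F" if "generate_topology_on ?S T" "g \<in> T" for T
    using that
  proof (induction T)
    case Empty
    then show ?case by simp
  next
    case (Int a b)
    then show ?case by (simp add: eventually_conj)
  next
    case (UN \<K>)
    then obtain k where "k \<in> \<K>" "eventually (\<lambda>n. f n \<in> k) F" by blast
    then show ?case by (auto elim: eventually_mono)
  next
    case (Basis s)
    then obtain K U where s: "s = {f \<in> cont_funs X. f ` K \<subseteq> U}" and K: "compactin X K" and U: "open U"
      by blast
    have "compact (g ` K)"
      using image_compactin[OF K, of euclideanreal g] g by (simp add: cont_funs_def)
    then obtain e where e: "e > 0" "(\<Union>y\<in>g ` K. ball y e) \<subseteq> U"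
      using compact_subset_open_imp_ball_epsilon_subset[of "g ` K" U] U Basis(2) s by blast
    show ?case
      using unif[OF K e(1)]
    proof (rule eventually_mono)
      fix n assume n: "\<forall>x\<in>K. \<bar>f n x - g x\<bar> < e"
      have "f n x \<in> U" if x: "x \<in> K" for x
      proof -
        have "f n x \<in> ball (g x) e"
          using n x by (simp add: dist_real_def abs_minus_commute)
        then show ?thesis using e(2) x by blast
      qed
      then show "f n \<in> s" using f by (auto simp: s)
    qed
  qed
  moreover have "g \<in> \<Union>?S"
    using g by (intro UnionI[of "{f \<in> cont_funs X. f ` {} \<subseteq> UNIV}"]) (auto intro!: exI[of _ "{}"])
  ultimately show ?thesis
    by (simp add: limitin_def compact_open_topology_def openin_topology_generated_by_iff)
qed

section \<open>Equicontinuity on a space and on its free locally convex space\<close>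

lemma lcs_euclidean: "lcs (euclidean :: 'a::real_normed_vector topology)"
  unfolding lcs_def
proof (intro conjI)
  show "continuous_map (prod_topology euclidean euclidean) euclidean (\<lambda>(x, y). x + y :: 'a)"
    by (simp add: case_prod_unfold continuous_map_iff_continuous2 continuous_intros
        flip: euclidean_product_topology)
  show "continuous_map (prod_topology euclideanreal euclidean) euclidean (\<lambda>(c, x). c *\<^sub>R x :: 'a)"
    by (simp add: case_prod_unfold continuous_map_iff_continuous2 continuous_intros
        flip: euclidean_product_topology)
  show "neighbourhood_base_at (0 :: 'a) convex euclidean"
    unfolding neighbourhood_base_at_def
    by (metis convex_ball centre_in_ball open_ball open_openin openE order_refl)
qed auto

text \<open>The supremum norm turns equicontinuity of a family into continuity of a single map. The index
  type is discrete, so that every bounded function on it is a bounded continuous function.\<close>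

lemma equicontinuous_family_imp_continuous_map_bcontfun:
  fixes f :: "'n::discrete_topology \<Rightarrow> 'x \<Rightarrow> real"
  assumes eq: "equicontinuous_family X (range f)"
    and bdd: "\<And>x. x \<in> topspace X \<Longrightarrow> bounded (range (\<lambda>n. f n x))"
  shows "continuous_map X euclidean (\<lambda>x. Bcontfun (\<lambda>n. f n x))" (is "continuous_map X _ ?F")
  unfolding continuous_map_def
proof (intro conjI allI impI)
  fix W :: "('n \<Rightarrow>\<^sub>C real) set" assume "openin euclidean W"
  then have W: "open W" by simp
  have app: "apply_bcontfun (?F x) n = f n x" if "x \<in> topspace X" for x n
    using bdd[OF that] by (subst Bcontfun_inverse) (auto simp: bcontfun_def)
  show "openin X {x \<in> topspace X. ?F x \<in> W}"
  proof (subst openin_subopen, intro ballI)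
    fix x assume x: "x \<in> {x \<in> topspace X. ?F x \<in> W}"
    then obtain e where e: "e > 0" "cball (?F x) e \<subseteq> W"
      using W open_contains_cball by blast
    have "\<exists>T. openin X T \<and> x \<in> T \<and> (\<forall>n. \<forall>y\<in>T. \<bar>f n y - f n x\<bar> < e)"
      using eq x e(1) by (simp add: equicontinuous_family_def)
    then obtain T where T: "openin X T" "x \<in> T" "\<forall>n. \<forall>y\<in>T. \<bar>f n y - f n x\<bar> < e"
      by blast
    have TX: "T \<subseteq> topspace X" using T(1) by (rule openin_subset)
    have "?F y \<in> W" if y: "y \<in> T" for y
    proof -
      have "dist (?F x) (?F y) \<le> e"
      proof (rule dist_bound)
        fix n
        have "\<bar>f n y - f n x\<bar> < e" using T(3) y by blast
        then show "dist (apply_bcontfun (?F x) n) (apply_bcontfun (?F y) n) \<le> e"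
          using app x y TX by (auto simp: dist_real_def abs_minus_commute)
      qed
      then show ?thesis using e(2) by auto
    qed
    then show "\<exists>T. openin X T \<and> x \<in> T \<and> T \<subseteq> {x \<in> topspace X. ?F x \<in> W}"
      using T TX by blast
  qed
qed auto

lemma evaluation_bcontfun_dual:
  "(\<lambda>h. apply_bcontfun h n) \<in> dual (euclidean :: ('n::topological_space \<Rightarrow>\<^sub>C real) topology)"
proof -
  have "continuous_on UNIV (\<lambda>h :: 'n \<Rightarrow>\<^sub>C real. apply_bcontfun h n)"
    unfolding continuous_on_iff
  proof (intro ballI allI impI)
    fix h :: "'n \<Rightarrow>\<^sub>C real" and e :: real assume e: "e > 0"
    show "\<exists>d>0. \<forall>k\<in>UNIV. dist k h < d \<longrightarrow> dist (apply_bcontfun k n) (apply_bcontfun h n) < e"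
      using e dist_bounded le_less_trans by blast
  qed
  then show ?thesis
    by (simp add: continuous_operators_def linear_map_on_def plus_bcontfun.rep_eq scaleR_bcontfun.rep_eq)
qed

text \<open>By the universal property the map \<open>x \<mapsto> (f n x)\<^sub>n\<close> into the bounded functions extends to \<open>L\<close>;
  applying the uniqueness part to real-valued maps identifies the coordinates of the extension.\<close>

lemma equicontinuous_functionals_free_lcs:
  fixes \<phi> :: "'n::discrete_topology \<Rightarrow> 'l::real_vector \<Rightarrow> real"
  assumes X: "tychonoff_space X" and L: "free_lcs X L i"
    and \<phi>: "\<And>n. \<phi> n \<in> dual L" and f: "\<And>n x. x \<in> topspace X \<Longrightarrow> \<phi> n (i x) = f n x"
    and eq: "equicontinuous_family X (range f)"
    and bdd: "\<And>x. x \<in> topspace X \<Longrightarrow> bounded (range (\<lambda>n. f n x))"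
  shows "equicontinuous_functionals L (range \<phi>)"
proof -
  let ?F = "\<lambda>x. Bcontfun (\<lambda>n. f n x)"
  have lcsL: "lcs L" and i: "continuous_map X L i" using L by (auto simp: free_lcs_def)
  have iL: "i x \<in> topspace L" if "x \<in> topspace X" for x
    using i that by (auto simp: continuous_map_def)
  have F: "continuous_map X euclidean ?F"
    by (rule equicontinuous_family_imp_continuous_map_bcontfun[OF eq bdd])
  have app: "apply_bcontfun (?F x) n = f n x" if "x \<in> topspace X" for x n
    using bdd[OF that] by (subst Bcontfun_inverse) (auto simp: bcontfun_def)
  obtain g where g: "g \<in> continuous_operators L euclidean" "\<forall>x\<in>topspace X. g (i x) = ?F x"
    using free_lcs_universal[OF X L lcs_euclidean] F unfolding extends_uniquely_def by blast
  have coord: "apply_bcontfun (g v) n = \<phi> n v" if v: "v \<in> topspace L" for n v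
  proof -
    let ?h = "restrict (\<lambda>v. apply_bcontfun (g v) n) (topspace L)"
    have h: "?h \<in> dual L"
      using continuous_operators_compose[OF lcs_subspace[OF lcsL] g(1) evaluation_bcontfun_dual] .
    have "continuous_map X euclideanreal (\<phi> n \<circ> i)"
      using \<phi>[of n] i by (auto simp: continuous_operators_def intro: continuous_map_compose)
    then have "\<exists>!k. k \<in> dual L \<and> (\<forall>x\<in>topspace X. k (i x) = (\<phi> n \<circ> i) x)"
      using free_lcs_universal[OF X L lcs_euclideanreal] unfolding extends_uniquely_def by blast
    moreover have "\<forall>x\<in>topspace X. ?h (i x) = (\<phi> n \<circ> i) x"
      using g(2) app f iL by simp
    ultimately have "?h = \<phi> n" using h \<phi>[of n] by auto
    then show ?thesis using v by (metis restrict_apply')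
  qed
  have cont: "continuous_map L euclidean g" and lin: "linear_map_on (topspace L) g"
    using g(1) by (auto simp: continuous_operators_def)
  let ?U = "{v \<in> topspace L. g v \<in> ball 0 1}"
  have "openin L ?U" by (rule openin_continuous_map_preimage[OF cont]) simp
  moreover have "g (0 *\<^sub>R 0) = 0 *\<^sub>R g 0"
    using lin zero_in_topspace_lcs[OF lcsL] unfolding linear_map_on_def by blast
  then have "0 \<in> ?U" using zero_in_topspace_lcs[OF lcsL] by simp
  ultimately have "zero_nbhd L ?U" unfolding zero_nbhd_def by blast
  moreover have "\<bar>\<phi> n v\<bar> \<le> 1" if "v \<in> ?U" for n v
  proof -
    have "\<bar>\<phi> n v\<bar> \<le> norm (g v)" using norm_bounded[of "g v" n] coord that by simp
    then show ?thesis using that by simp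
  qed
  then have "range \<phi> \<subseteq> polar L ?U" using \<phi> by (auto simp: polar_def)
  ultimately show ?thesis unfolding equicontinuous_functionals_def by blast
qed

theorem theorem1p2:
  fixes X :: "'x topology" and L :: "'l::real_vector topology" and i :: "'x \<Rightarrow> 'l"
  assumes "tychonoff_space X"
    and "mu_space X"
    and "sequentially_ascoli X"
    and "free_lcs X L i"
  shows "c0_quasibarrelled L"
  unfolding c0_quasibarrelled_def
proof (intro conjI allI impI)
  show lcsL: "lcs L" using assms(4) by (simp add: free_lcs_def)
  have i: "continuous_map X L i" using assms(4) by (simp add: free_lcs_def)
  fix \<phi> :: "nat \<Rightarrow> 'l \<Rightarrow> real"
  assume "(\<forall>n. \<phi> n \<in> dual L) \<and> limitin (strong_topology L) \<phi> (zero_functional L) sequentially"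
  then have \<phi>: "\<phi> n \<in> dual L" and lim: "limitin (strong_topology L) \<phi> (zero_functional L) sequentially"
    for n by auto
  define f where "f n = restrict (\<lambda>x. \<phi> n (i x)) (topspace X)" for n
  define g where "g = restrict (\<lambda>x. 0 :: real) (topspace X)"
  have f: "f n \<in> cont_funs X" for n
  proof -
    have "continuous_map X euclideanreal (\<phi> n \<circ> i)"
      using \<phi>[of n] i by (auto simp: continuous_operators_def intro: continuous_map_compose)
    then have "continuous_map X euclideanreal (f n)"
      by (rule continuous_map_eq) (simp add: f_def)
    then show ?thesis by (simp add: cont_funs_def f_def)
  qed
  have g: "g \<in> cont_funs X"
    using continuous_map_eq[of X euclideanreal "\<lambda>x. 0" g] by (simp add: cont_funs_def g_def)
  have unif: "eventually (\<lambda>n. \<forall>x\<in>K. \<bar>f n x - g x\<bar> < e) sequentially"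
    if K: "compactin X K" and e: "e > 0" for K e
  proof -
    have KX: "K \<subseteq> topspace X" using K by (rule compactin_subset_topspace)
    have "i x \<in> topspace L" if "x \<in> topspace X" for x
      using i that by (auto simp: continuous_map_def)
    moreover have "lcs_bounded L (i ` K)"
      by (rule compactin_imp_lcs_bounded[OF lcsL image_compactin[OF K i]])
    then have "eventually (\<lambda>n. \<forall>v\<in>i ` K. \<bar>\<phi> n v - zero_functional L v\<bar> < e) sequentially"
      by (rule strong_limit_uniform_on_bounded[OF lim _ e])
    ultimately show ?thesis
      using KX by (auto elim!: eventually_mono simp: f_def g_def zero_functional_def subset_iff)
  qed
  have "limitin (compact_open_topology X) f g sequentially"
    by (rule limitin_compact_open_topologyI[OF f g unif])
  then have eq: "equicontinuous_family X (range f)"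
    using assms(3) f unfolding sequentially_ascoli_def by blast
  have "bounded (range (\<lambda>n. f n x))" if x: "x \<in> topspace X" for x
  proof -
    have "(\<lambda>n. f n x) \<longlonglongrightarrow> g x"
      using unif[of "{x}"] x by (intro tendstoI) (simp add: dist_real_def)
    then show ?thesis by (rule convergent_imp_bounded)
  qed
  then show "equicontinuous_functionals L (range \<phi>)"
    by (intro equicontinuous_functionals_free_lcs[OF assms(1,4) \<phi> _ eq]) (auto simp: f_def)
qed

end
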